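(* Let $\Pi_1$ and $\Pi_2$ be two inner products on $\mathbb{R}^n$, and let $X=\mathbb{R}^n$ be the real normed space with the norm $$\|x\|=\sqrt{\max\{\Pi_1(x,x),\Pi_2(x,x)\}}.$$ Then every 2-polynomial defined on a linear subspace of $X$ can be extended to $X$ preserving the norm; that is, for every linear subspace $Y\subseteq X$ and every 2-polynomial $P:Y\to\mathbb{R}$ there is a 2-polynomial $\tilde P:X\to\mathbb{R}$ such that $\tilde P(y)=P(y)$ for all $y\in Y$ and $\|\tilde P\|=\|P\|$.
   Context: Let $Z$ be a normed linear space over $\mathbb{K}$ ($\mathbb{R}$ or $\mathbb{C}$). A function $P:Z\to\mathbb{K}$ is a 2-polynomial if there is a $\mathbb{K}$-bilinear functional $\Pi:Z\times Z\to\mathbb{K}$ such that $P(x)=\Pi(x,x)$ for every $x\in Z$. The norm of $P$ is $\|P\|=\sup\{|P(x)|: x\in Z,\ \|x\|=1\}$. A linear subspace $Y$ of $X$ carries the norm restricted from $X$, so the norm of a 2-polynomial on $Y$ is the supremum over unit vectors of $Y$. *)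

theory Defs
  imports "HOL-Analysis.Analysis"
begin

definition is_inner_product :: "('a::real_vector \<Rightarrow> 'a \<Rightarrow> real) \<Rightarrow> bool" where
  "is_inner_product B \<longleftrightarrow>
     bilinear B \<and> (\<forall>x y. B x y = B y x) \<and> (\<forall>x. x \<noteq> 0 \<longrightarrow> B x x > 0)"

(* Functionals on a subspace Y are represented by total functions; only their values on Y matter. *)
definition bilinear_on :: "'a::real_vector set \<Rightarrow> ('a \<Rightarrow> 'a \<Rightarrow> real) \<Rightarrow> bool" where
  "bilinear_on Y B \<longleftrightarrow>
     (\<forall>x\<in>Y. \<forall>y\<in>Y. \<forall>z\<in>Y. B (x + y) z = B x z + B y z \<and> B z (x + y) = B z x + B z y) \<and>
     (\<forall>x\<in>Y. \<forall>y\<in>Y. \<forall>c. B (c *\<^sub>R x) y = c * B x y \<and> B x (c *\<^sub>R y) = c * B x y)"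

lemma bilinear_on_UNIV: "bilinear_on UNIV B \<longleftrightarrow> bilinear B"
  unfolding bilinear_on_def bilinear_def linear_iff by auto

definition two_polynomial_on :: "'a::real_vector set \<Rightarrow> ('a \<Rightarrow> real) \<Rightarrow> bool" where
  "two_polynomial_on Y P \<longleftrightarrow> (\<exists>B. bilinear_on Y B \<and> (\<forall>x\<in>Y. P x = B x x))"

(* N is the norm of the ambient space. The supremum is taken in [0, \<infinity>], so that it is 0
   when Y = {0} has no unit vectors. *)
definition two_polynomial_norm :: "('a \<Rightarrow> real) \<Rightarrow> 'a set \<Rightarrow> ('a \<Rightarrow> real) \<Rightarrow> ennreal" where
  "two_polynomial_norm N Y P = (SUP x\<in>{x\<in>Y. N x = 1}. ennreal \<bar>P x\<bar>)"

definition max_norm :: "('a \<Rightarrow> 'a \<Rightarrow> real) \<Rightarrow> ('a \<Rightarrow> 'a \<Rightarrow> real) \<Rightarrow> 'a \<Rightarrow> real" where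
  "max_norm B1 B2 x = sqrt (max (B1 x x) (B2 x x))"

end

theory Submission
  imports Defs
begin

text \<open>
  Write \<open>A\<close> and \<open>B\<close> for the quadratic forms of the two inner products and \<open>c\<close> for the norm of
  \<open>P\<close> on \<open>Y\<close>, so that \<open>\<bar>P\<bar> \<le> c max(A, B)\<close> on \<open>Y\<close>.  The maximum is not a quadratic form, but
  the upper and the lower bound can each be replaced by a quadratic one.  The reason is Yuan's
  alternative (\<open>yuan_alternative\<close>): if the maximum of two quadratic forms is nonnegative, then
  so is one of their convex combinations.  Applied to \<open>cA - P\<close>, \<open>cB - P\<close> and to \<open>cA + P\<close>,
  \<open>cB + P\<close>, it yields convex combinations \<open>C\<close> and \<open>D\<close> of \<open>A\<close> and \<open>B\<close> with
  \<open>-cD \<le> P \<le> cC\<close> on \<open>Y\<close>.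

  Now \<open>P + cD\<close> lies between \<open>0\<close> and \<open>c(C + D)\<close> on \<open>Y\<close>, and \<open>C + D\<close> is again an inner product.
  Its orthogonal projection \<open>p\<close> onto \<open>Y\<close> (\<open>orthogonal_projection_exists\<close>) does not increase
  \<open>C + D\<close>, hence \<open>(P + cD) \<circ> p\<close> lies between \<open>0\<close> and \<open>c(C + D)\<close> on the whole space.
  Subtracting \<open>cD\<close> gives an extension of \<open>P\<close> that lies between \<open>-cD\<close> and \<open>cC\<close>; both \<open>C\<close> and \<open>D\<close>
  are at most \<open>max(A, B)\<close>, so the extension has norm at most \<open>c\<close>.
\<close>

section \<open>Quadratic forms on a subspace\<close>

lemma bilinear_on_combination:
  assumes "bilinear_on Y b1" "bilinear_on Y b2"
  shows "bilinear_on Y (\<lambda>x y. s * b1 x y + t * b2 x y)"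
  using assms unfolding bilinear_on_def by (simp add: algebra_simps)

lemma bilinear_on_UNIV_imp: "bilinear_on UNIV b \<Longrightarrow> bilinear_on Y b"
  unfolding bilinear_on_def by simp

lemma bilinear_on_comp_linear:
  assumes "bilinear_on Y b" "linear p" "\<And>x. p x \<in> Y"
  shows "bilinear_on UNIV (\<lambda>x y. b (p x) (p y))"
  using assms by (simp add: bilinear_on_def linear_add linear_scale)

lemma quadratic_form_on_line:
  assumes b: "bilinear_on Y b" and Y: "subspace Y" and x: "x \<in> Y" and y: "y \<in> Y"
  shows "b (u *\<^sub>R x + v *\<^sub>R y) (u *\<^sub>R x + v *\<^sub>R y)
       = u\<^sup>2 * b x x + u * v * (b x y + b y x) + v\<^sup>2 * b y y"
proof -
  have ux: "u *\<^sub>R x \<in> Y" and vy: "v *\<^sub>R y \<in> Y"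
    using Y x y by (auto intro: subspace_scale)
  then have uv: "u *\<^sub>R x + v *\<^sub>R y \<in> Y"
    using Y by (auto intro: subspace_add)
  have add1: "b (p + q) r = b p r + b q r" and add2: "b r (p + q) = b r p + b r q"
    if "p \<in> Y" "q \<in> Y" "r \<in> Y" for p q r
    using b that unfolding bilinear_on_def by blast+
  have scale1: "b (k *\<^sub>R p) q = k * b p q" and scale2: "b p (k *\<^sub>R q) = k * b p q"
    if "p \<in> Y" "q \<in> Y" for p q k
    using b that unfolding bilinear_on_def by blast+
  show ?thesis
    using ux vy uv x y
    by (simp add: add1 add2 scale1 scale2 power2_eq_square algebra_simps)
qed

lemma quadratic_form_scale:
  assumes "bilinear_on Y b" "subspace Y" "x \<in> Y"
  shows "b (k *\<^sub>R x) (k *\<^sub>R x) = k\<^sup>2 * b x x"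
  using quadratic_form_on_line[OF assms assms(3), of k 0] by simp

section \<open>Yuan's alternative\<close>

text \<open>
  Both uses of connectedness in the proof below have this form: two open conditions that cover an
  interval and hold at opposite ends must hold together somewhere.
\<close>

lemma open_cover_unit_interval_meets:
  fixes U V :: "real set"
  assumes "open U" "open V" "{0..1} \<subseteq> U \<union> V" "0 \<in> U" "1 \<in> V"
  obtains t where "t \<in> {0..1}" "t \<in> U" "t \<in> V"
  using connectedD[OF connected_Icc[of 0 "1::real"] assms(1,2)] assms(3-5)
  by fastforce

text \<open>
  Suppose a combination of the two forms is negative at \<open>x\<close> and at \<open>y\<close>.  Replacing \<open>y\<close> by \<open>-y\<close>
  if necessary makes its mixed term nonpositive, and then it is negative on the whole segment from
  \<open>x\<close> to \<open>y\<close>, so that at each point of the segment at least one of the two forms is negative.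
\<close>

lemma both_forms_negative:
  assumes Y: "subspace Y" and b1: "bilinear_on Y b1" and b2: "bilinear_on Y b2"
    and x: "x \<in> Y" and y: "y \<in> Y" and t: "0 \<le> t" "t \<le> 1"
    and neg: "t * b1 x x + (1 - t) * b2 x x < 0" "t * b1 y y + (1 - t) * b2 y y < 0"
    and x1: "b1 x x < 0" and y2: "b2 y y < 0"
  shows "\<exists>z\<in>Y. b1 z z < 0 \<and> b2 z z < 0"
proof -
  define b where "b = (\<lambda>x y. t * b1 x y + (1 - t) * b2 x y)"
  have b: "bilinear_on Y b"
    unfolding b_def using b1 b2 by (rule bilinear_on_combination)
  define e :: real where "e = (if b x y + b y x \<le> 0 then 1 else -1)"
  define w where "w = e *\<^sub>R y"
  have w: "w \<in> Y" unfolding w_def using Y y by (rule subspace_scale)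
  have e2: "e\<^sup>2 = 1" by (simp add: e_def)
  have ww: "c w w = c y y" if "bilinear_on Y c" for c
    unfolding w_def using quadratic_form_scale[OF that Y y, of e] e2 by simp
  have "b x w + b w x = e * (b x y + b y x)"
    using b x y unfolding w_def bilinear_on_def by (simp add: distrib_left)
  then have mixed: "b x w + b w x \<le> 0"
    by (auto simp: e_def)
  define z where "z = (\<lambda>s. (1 - s) *\<^sub>R x + s *\<^sub>R w)"
  have zY: "z s \<in> Y" for s
    unfolding z_def using Y x w by (auto intro: subspace_add subspace_scale)
  have cont: "continuous_on UNIV (\<lambda>s. c (z s) (z s))" if "bilinear_on Y c" for c
    unfolding z_def quadratic_form_on_line[OF that Y x w] by (intro continuous_intros)
  have op: "open {s. c (z s) (z s) < 0}" if "bilinear_on Y c" for c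
    using open_Collect_less[OF cont[OF that] continuous_on_const] by simp
  have bz: "b (z s) (z s) < 0" if "s \<in> {0..1}" for s
  proof -
    have "b x x < 0" "b w w < 0"
      using neg ww[OF b] by (simp_all add: b_def)
    moreover have "(1 - s)\<^sup>2 > 0 \<or> s\<^sup>2 > 0"
      by (cases "s = 0") auto
    ultimately have "(1 - s)\<^sup>2 * b x x + s\<^sup>2 * b w w < 0"
      by (smt (verit) mult_nonneg_nonpos mult_pos_neg zero_le_power2)
    moreover have "(1 - s) * s * (b x w + b w x) \<le> 0"
      using that mixed by (auto intro: mult_nonneg_nonpos)
    ultimately show ?thesis
      unfolding z_def quadratic_form_on_line[OF b Y x w] by linarith
  qed
  have cover: "{0..1} \<subseteq> {s. b1 (z s) (z s) < 0} \<union> {s. b2 (z s) (z s) < 0}"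
  proof
    fix s :: real assume "s \<in> {0..1}"
    then have "t * b1 (z s) (z s) + (1 - t) * b2 (z s) (z s) < 0"
      using bz by (simp add: b_def)
    then show "s \<in> {s. b1 (z s) (z s) < 0} \<union> {s. b2 (z s) (z s) < 0}"
      using t by (smt (verit) Un_iff mem_Collect_eq mult_nonneg_nonneg)
  qed
  have "0 \<in> {s. b1 (z s) (z s) < 0}" "1 \<in> {s. b2 (z s) (z s) < 0}"
    using x1 y2 ww[OF b2] by (simp_all add: z_def)
  with open_cover_unit_interval_meets[OF op[OF b1] op[OF b2] cover] zY
  show ?thesis by blast
qed

text \<open>
  If every convex combination were negative somewhere, the weights \<open>t\<close> would be covered by
  two open sets: those for which a point of negativity can be found where \<open>b1\<close> is negative, and
  likewise for \<open>b2\<close>.  The weights 1 and 0 belong to the first and the second set, so some weight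
  belongs to both, which is the situation of the previous lemma.
\<close>

lemma yuan_alternative:
  assumes Y: "subspace Y" and b1: "bilinear_on Y b1" and b2: "bilinear_on Y b2"
    and max: "\<And>x. x \<in> Y \<Longrightarrow> 0 \<le> max (b1 x x) (b2 x x)"
  obtains t where "0 \<le> t" "t \<le> 1" "\<And>x. x \<in> Y \<Longrightarrow> 0 \<le> t * b1 x x + (1 - t) * b2 x x"
proof (rule ccontr)
  assume "\<not> thesis"
  with that have neg: "\<exists>x\<in>Y. t * b1 x x + (1 - t) * b2 x x < 0" if "t \<in> {0..1}" for t
    using \<open>t \<in> {0..1}\<close> by (metis atLeastAtMost_iff not_le)
  define T where "T = (\<lambda>c :: 'a \<Rightarrow> 'a \<Rightarrow> real.
    \<Union>x\<in>{x\<in>Y. c x x < 0}. {t. t * b1 x x + (1 - t) * b2 x x < 0})"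
  have "open (T c)" for c
    unfolding T_def by (intro open_UN ballI open_Collect_less continuous_intros)
  moreover have "{0..1} \<subseteq> T b2 \<union> T b1"
  proof
    fix t :: real assume t: "t \<in> {0..1}"
    then obtain x where x: "x \<in> Y" "t * b1 x x + (1 - t) * b2 x x < 0"
      using neg by blast
    then have "b1 x x < 0 \<or> b2 x x < 0"
      using t by (smt (verit) atLeastAtMost_iff mult_nonneg_nonneg)
    then show "t \<in> T b2 \<union> T b1"
      using x by (auto simp: T_def)
  qed
  moreover have "0 \<in> T b2" "1 \<in> T b1"
    using neg[of 0] neg[of 1] by (auto simp: T_def)
  ultimately obtain t where "t \<in> {0..1}" "t \<in> T b2" "t \<in> T b1"
    by (metis open_cover_unit_interval_meets)
  then obtain x y where "x \<in> Y" "y \<in> Y" "0 \<le> t" "t \<le> 1" "b1 x x < 0" "b2 y y < 0"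
    "t * b1 x x + (1 - t) * b2 x x < 0" "t * b1 y y + (1 - t) * b2 y y < 0"
    by (auto simp: T_def)
  then have "\<exists>z\<in>Y. b1 z z < 0 \<and> b2 z z < 0"
    by (intro both_forms_negative[OF Y b1 b2])
  then show False
    using max by fastforce
qed

text \<open>
  A quadratic form dominated by \<open>c max(A, B)\<close> is dominated by a single convex combination of
  \<open>cA\<close> and \<open>cB\<close>: Yuan's alternative for \<open>cA - q\<close> and \<open>cB - q\<close>.
\<close>

lemma dominated_by_convex_combination:
  assumes Y: "subspace Y" and A: "bilinear_on Y A" and B: "bilinear_on Y B"
    and q: "bilinear_on Y q"
    and le: "\<And>x. x \<in> Y \<Longrightarrow> q x x \<le> c * max (A x x) (B x x)"
  obtains t where "0 \<le> t" "t \<le> 1"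
    "\<And>x. x \<in> Y \<Longrightarrow> q x x \<le> c * (t * A x x + (1 - t) * B x x)"
proof -
  define a where "a = (\<lambda>x y. c * A x y + (-1) * q x y)"
  define b where "b = (\<lambda>x y. c * B x y + (-1) * q x y)"
  have "bilinear_on Y a" "bilinear_on Y b"
    unfolding a_def b_def by (intro bilinear_on_combination A B q)+
  moreover have "0 \<le> max (a x x) (b x x)" if "x \<in> Y" for x
    using le[OF that] by (auto simp: a_def b_def max_def split: if_splits)
  ultimately obtain t where t: "0 \<le> t" "t \<le> 1"
      and nonneg: "\<And>x. x \<in> Y \<Longrightarrow> 0 \<le> t * a x x + (1 - t) * b x x"
    using yuan_alternative[OF Y] by blast
  have "q x x \<le> c * (t * A x x + (1 - t) * B x x)" if "x \<in> Y" for x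
    using nonneg[OF that] by (simp add: a_def b_def algebra_simps)
  with t that show thesis by blast
qed

section \<open>Orthogonal projections for an arbitrary inner product\<close>

lemma is_inner_productD:
  assumes "is_inner_product E"
  shows "bilinear_on UNIV E" "E x y = E y x" "0 \<le> E x x" "x \<noteq> 0 \<Longrightarrow> 0 < E x x"
proof -
  show bil: "bilinear_on UNIV E"
    using assms by (simp add: is_inner_product_def bilinear_on_UNIV)
  show "E x y = E y x" and pos: "x \<noteq> 0 \<Longrightarrow> 0 < E x x"
    using assms by (simp_all add: is_inner_product_def)
  show "0 \<le> E x x"
    using pos quadratic_form_scale[OF bil subspace_UNIV, of x 0] by (cases "x = 0") auto
qed

lemma is_inner_product_combination:
  assumes "is_inner_product E" "is_inner_product F" "0 \<le> s" "0 \<le> t" "0 < s + t"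
  shows "is_inner_product (\<lambda>x y. s * E x y + t * F x y)"
proof -
  have "0 < s * E x x + t * F x x" if "x \<noteq> 0" for x
  proof -
    have "0 < E x x" "0 < F x x"
      using that assms(1,2) by (auto intro: is_inner_productD(4))
    moreover have "0 < s \<or> 0 < t"
      using assms(3-5) by linarith
    ultimately show ?thesis
      using assms(3,4) by (auto intro: add_pos_nonneg add_nonneg_pos)
  qed
  moreover have "bilinear_on UNIV (\<lambda>x y. s * E x y + t * F x y)"
    using assms(1,2) by (intro bilinear_on_combination is_inner_productD(1))
  ultimately show ?thesis
    using assms(1,2) by (simp add: is_inner_product_def bilinear_on_UNIV)
qed

text \<open>
  One step of the Gram--Schmidt process adds the component along the part of the new vector that is
  orthogonal to the old ones.
\<close>

lemma gram_schmidt_projection: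
  assumes E: "is_inner_product E" and "finite S"
  shows "\<exists>p. linear p \<and> (\<forall>x. p x \<in> span S) \<and> (\<forall>x. \<forall>y\<in>span S. E (x - p x) y = 0)"
  using \<open>finite S\<close>
proof (induction S rule: finite_induct)
  have bil: "bilinear E"
    using E by (simp add: is_inner_product_def)
  case empty
  show ?case
    using bilinear_rzero[OF bil] by (intro exI[of _ "\<lambda>x. 0"]) (simp add: linear_zero)
next
  have bil: "bilinear E"
    using E by (simp add: is_inner_product_def)
  case (insert a S)
  then obtain p where p: "linear p" "\<And>x. p x \<in> span S"
      and orth: "\<And>x y. y \<in> span S \<Longrightarrow> E (x - p x) y = 0"
    by blast
  define u where "u = a - p a"
  \<comment> \<open>If \<open>a\<close> already lies in the span, then \<open>u = 0\<close> and the added term vanishes.\<close>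
  define r where "r = (\<lambda>x. p x + (E x u / E u u) *\<^sub>R u)"
  have spanS: "span S \<subseteq> span (insert a S)"
    by (intro span_mono) auto
  have uspan: "u \<in> span (insert a S)"
    unfolding u_def using p(2) spanS by (auto intro!: span_diff intro: span_base)
  have "linear r"
    unfolding r_def using p(1) bil
    by (intro linearI)
      (simp_all add: linear_add linear_scale bilinear_ladd bilinear_lmul
        add_divide_distrib scaleR_add_left scaleR_add_right)
  moreover have "r x \<in> span (insert a S)" for x
    unfolding r_def using p(2) spanS uspan by (intro span_add span_scale) auto
  moreover have "E (x - r x) y = 0" if y: "y \<in> span (insert a S)" for x y
  proof -
    have uS: "E u s = 0" if "s \<in> span S" for s
      unfolding u_def using orth that by blast
    have rx: "x - r x = (x - p x) - (E x u / E u u) *\<^sub>R u"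
      by (simp add: r_def)
    have rS: "E (x - r x) s = 0" if "s \<in> span S" for s
      unfolding rx using uS[OF that] orth[OF that] bil
      by (simp add: bilinear_lsub bilinear_lmul)
    have "E (x - r x) u = E x u - E (p x) u - (E x u / E u u) * E u u"
      unfolding rx using bil by (simp add: bilinear_lsub bilinear_lmul)
    moreover have "E (p x) u = 0"
      using uS[OF p(2)] is_inner_productD(2)[OF E] by metis
    ultimately have ru: "E (x - r x) u = 0"
      using is_inner_productD(4)[OF E, of u] bilinear_rzero[OF bil] by (cases "u = 0") auto
    obtain k where k: "y - k *\<^sub>R a \<in> span S"
      using y by (auto simp: span_insert)
    have split: "y = (y - k *\<^sub>R a) + k *\<^sub>R p a + k *\<^sub>R u"
      by (simp add: u_def algebra_simps)
    have "E (x - r x) ((y - k *\<^sub>R a) + k *\<^sub>R p a + k *\<^sub>R u) = 0"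
      using rS[OF k] rS[OF p(2)] ru
      by (simp only: bilinear_radd[OF bil] bilinear_rmul[OF bil]) simp
    then show ?thesis
      by (simp only: split[symmetric])
  qed
  ultimately show ?case by blast
qed

lemma orthogonal_projection_exists:
  fixes Y :: "'a::euclidean_space set"
  assumes E: "is_inner_product E" and Y: "subspace Y"
  obtains p where "linear p" "\<And>x. p x \<in> Y" "\<And>y. y \<in> Y \<Longrightarrow> p y = y"
    "\<And>x. E (p x) (p x) \<le> E x x"
proof -
  have bil: "bilinear E"
    using E by (simp add: is_inner_product_def)
  obtain S where "independent S" "span S = Y"
    using basis_subspace_exists[OF Y] by metis
  then obtain p where p: "linear p" "\<And>x. p x \<in> Y"
      and orth: "\<And>x y. y \<in> Y \<Longrightarrow> E (x - p x) y = 0"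
    using gram_schmidt_projection[OF E] finiteI_independent by metis
  have "p y = y" if "y \<in> Y" for y
  proof -
    have "y - p y \<in> Y"
      using Y that p(2) by (rule subspace_diff)
    then have "E (y - p y) (y - p y) = 0"
      by (rule orth)
    then show ?thesis
      using is_inner_productD(4)[OF E, of "y - p y"] by fastforce
  qed
  moreover have "E (p x) (p x) \<le> E x x" for x
  proof -
    have 1: "E (x - p x) (p x) = 0" and 2: "E (p x) (x - p x) = 0"
      using orth[OF p(2)] is_inner_productD(2)[OF E] by metis+
    have "E x x = E (x - p x) (x - p x) + E (p x) (p x)"
      using 1 2 bil by (simp add: bilinear_lsub bilinear_rsub)
    then show ?thesis
      using is_inner_productD(3)[OF E, of "x - p x"] by linarith
  qed
  ultimately show thesis
    using that p by blast
qed

section \<open>Extension of a 2-polynomial\<close>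

text \<open>
  Shifting by \<open>cD\<close> turns the two-sided bound into the bounds \<open>0\<close> and \<open>c(C + D)\<close>, both of which
  survive composition with the orthogonal projection for \<open>C + D\<close>.
\<close>

lemma extend_between_inner_products:
  fixes Y :: "'a::euclidean_space set"
  assumes C: "is_inner_product C" and D: "is_inner_product D" and "0 \<le> c"
    and Y: "subspace Y" and b: "bilinear_on Y b"
    and bounds: "\<And>y. y \<in> Y \<Longrightarrow> - c * D y y \<le> b y y \<and> b y y \<le> c * C y y"
  obtains b' where "bilinear_on UNIV b'" "\<And>y. y \<in> Y \<Longrightarrow> b' y y = b y y"
    "\<And>x. - c * D x x \<le> b' x x \<and> b' x x \<le> c * C x x"
proof -
  define E where "E = (\<lambda>x y. 1 * C x y + 1 * D x y)"
  have "is_inner_product E"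
    unfolding E_def using C D by (intro is_inner_product_combination) auto
  then obtain p where p: "linear p" "\<And>x. p x \<in> Y" and id: "\<And>y. y \<in> Y \<Longrightarrow> p y = y"
      and contr: "\<And>x. E (p x) (p x) \<le> E x x"
    using orthogonal_projection_exists[OF _ Y] by metis
  define g where "g = (\<lambda>x y. 1 * b x y + c * D x y)"
  define b' where "b' = (\<lambda>x y. 1 * g (p x) (p y) + (- c) * D x y)"
  have "bilinear_on Y g"
    unfolding g_def using b bilinear_on_UNIV_imp[OF is_inner_productD(1)[OF D]]
    by (rule bilinear_on_combination)
  then have "bilinear_on UNIV b'"
    unfolding b'_def using p is_inner_productD(1)[OF D]
    by (intro bilinear_on_combination bilinear_on_comp_linear[of Y g])
  moreover have "b' y y = b y y" if "y \<in> Y" for y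
    using id[OF that] by (simp add: b'_def g_def)
  moreover have "- c * D x x \<le> b' x x \<and> b' x x \<le> c * C x x" for x
  proof -
    have "0 \<le> g (p x) (p x)" "g (p x) (p x) \<le> c * E (p x) (p x)"
      using bounds[OF p(2)[of x]] by (simp_all add: g_def E_def algebra_simps)
    moreover have "c * E (p x) (p x) \<le> c * E x x"
      using contr \<open>0 \<le> c\<close> by (rule mult_left_mono)
    ultimately show ?thesis
      by (simp add: b'_def E_def algebra_simps)
  qed
  ultimately show thesis
    using that by blast
qed

lemma extend_bounded_by_max:
  fixes Y :: "'a::euclidean_space set"
  assumes A: "is_inner_product A" and B: "is_inner_product B" and c: "0 \<le> c"
    and Y: "subspace Y" and b: "bilinear_on Y b"
    and bound: "\<And>y. y \<in> Y \<Longrightarrow> \<bar>b y y\<bar> \<le> c * max (A y y) (B y y)"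
  obtains b' where "bilinear_on UNIV b'" "\<And>y. y \<in> Y \<Longrightarrow> b' y y = b y y"
    "\<And>x. \<bar>b' x x\<bar> \<le> c * max (A x x) (B x x)"
proof -
  have AB: "bilinear_on Y A" "bilinear_on Y B"
    using A B by (simp_all add: bilinear_on_UNIV_imp is_inner_productD(1))
  have neg: "bilinear_on Y (\<lambda>x y. - b x y)"
    using bilinear_on_combination[OF b b, of "-1" 0] by simp
  have le: "b y y \<le> c * max (A y y) (B y y)" "- b y y \<le> c * max (A y y) (B y y)"
    if "y \<in> Y" for y
    using bound[OF that] by linarith+
  obtain t where t: "0 \<le> t" "t \<le> 1"
      and upper: "\<And>y. y \<in> Y \<Longrightarrow> b y y \<le> c * (t * A y y + (1 - t) * B y y)"
    using dominated_by_convex_combination[OF Y AB b le(1)] by blast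
  obtain s where s: "0 \<le> s" "s \<le> 1"
      and lower: "\<And>y. y \<in> Y \<Longrightarrow> - b y y \<le> c * (s * A y y + (1 - s) * B y y)"
    using dominated_by_convex_combination[OF Y AB neg le(2)] by blast
  define C where "C = (\<lambda>x y. t * A x y + (1 - t) * B x y)"
  define D where "D = (\<lambda>x y. s * A x y + (1 - s) * B x y)"
  have CD: "is_inner_product C" "is_inner_product D"
    unfolding C_def D_def using A B s t by (auto intro: is_inner_product_combination)
  have "- c * D y y \<le> b y y \<and> b y y \<le> c * C y y" if "y \<in> Y" for y
    using upper[OF that] lower[OF that] by (simp add: C_def D_def)
  then obtain b' where b': "bilinear_on UNIV b'" "\<And>y. y \<in> Y \<Longrightarrow> b' y y = b y y"
      and bounds: "\<And>x. - c * D x x \<le> b' x x \<and> b' x x \<le> c * C x x"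
    using extend_between_inner_products[OF CD c Y b] by blast
  have convex: "k * a + (1 - k) * d \<le> max a d" if "0 \<le> k" "k \<le> 1" for k a d :: real
    using that by (intro convex_bound_le) auto
  have "\<bar>b' x x\<bar> \<le> c * max (A x x) (B x x)" for x
  proof -
    have "c * C x x \<le> c * max (A x x) (B x x)" "c * D x x \<le> c * max (A x x) (B x x)"
      unfolding C_def D_def by (intro mult_left_mono convex s t c)+
    then show ?thesis
      using bounds[of x] by (simp add: abs_le_iff)
  qed
  with b' that show thesis by blast
qed

lemma max_norm_square:
  assumes "is_inner_product A" "is_inner_product B"
  shows "(max_norm A B x)\<^sup>2 = max (A x x) (B x x)"
  using is_inner_productD(3)[OF assms(1), of x] by (simp add: max_norm_def le_max_iff_disj)

lemma max_norm_pos: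
  assumes "is_inner_product A" "x \<noteq> 0"
  shows "0 < max_norm A B x"
  using is_inner_productD(4)[OF assms] by (simp add: max_norm_def less_max_iff_disj)

lemma max_norm_scale:
  assumes "is_inner_product A" "is_inner_product B"
  shows "max_norm A B (k *\<^sub>R x) = \<bar>k\<bar> * max_norm A B x"
proof -
  have "max (k\<^sup>2 * a) (k\<^sup>2 * d) = k\<^sup>2 * max a d" for a d :: real
    using max_mult_distrib_left[of "k\<^sup>2" a d] by simp
  then show ?thesis
    using quadratic_form_scale[OF is_inner_productD(1)[OF assms(1)] subspace_UNIV, of x k]
      quadratic_form_scale[OF is_inner_productD(1)[OF assms(2)] subspace_UNIV, of x k]
    by (simp add: max_norm_def real_sqrt_mult)
qed

text \<open>A finite norm controls the quadratic form everywhere, by homogeneity of degree two.\<close>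

lemma two_polynomial_norm_bound:
  assumes A: "is_inner_product A" and B: "is_inner_product B" and Y: "subspace Y"
    and b: "bilinear_on Y b" and P: "\<And>y. y \<in> Y \<Longrightarrow> P y = b y y"
    and c: "0 \<le> c" and norm: "two_polynomial_norm (max_norm A B) Y P \<le> ennreal c" and y: "y \<in> Y"
  shows "\<bar>b y y\<bar> \<le> c * max (A y y) (B y y)"
proof (cases "y = 0")
  case True
  then show ?thesis
    using quadratic_form_scale[OF b Y y, of 0]
      quadratic_form_scale[OF is_inner_productD(1)[OF A] subspace_UNIV, of y 0]
      quadratic_form_scale[OF is_inner_productD(1)[OF B] subspace_UNIV, of y 0] by simp
next
  case False
  define r where "r = max_norm A B y"
  have r: "0 < r"
    unfolding r_def using A False by (rule max_norm_pos)
  define u where "u = inverse r *\<^sub>R y"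
  have u: "u \<in> Y"
    unfolding u_def using Y y by (rule subspace_scale)
  have "max_norm A B u = 1"
    unfolding u_def max_norm_scale[OF A B] using r by (simp flip: r_def)
  then have "ennreal \<bar>P u\<bar> \<le> ennreal c"
    using u norm unfolding two_polynomial_norm_def by (simp add: SUP_le_iff)
  then have "\<bar>b u u\<bar> \<le> c"
    using c P[OF u] by (simp add: ennreal_le_iff)
  moreover have "y = r *\<^sub>R u"
    using r by (simp add: u_def)
  then have "b y y = r\<^sup>2 * b u u"
    using quadratic_form_scale[OF b Y u, of r] by simp
  ultimately have "\<bar>b y y\<bar> \<le> c * r\<^sup>2"
    by (simp add: abs_mult mult.commute[of c] mult_left_mono)
  then show ?thesis
    unfolding r_def max_norm_square[OF A B] .
qed

theorem theorem3:
  fixes \<Pi>1 \<Pi>2 :: "real ^ 'n \<Rightarrow> real ^ 'n \<Rightarrow> real"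
    and Y :: "(real ^ 'n) set"
    and P :: "real ^ 'n \<Rightarrow> real"
  assumes "is_inner_product \<Pi>1"
    and "is_inner_product \<Pi>2"
    and "subspace Y"
    and "two_polynomial_on Y P"
  shows "\<exists>P'. two_polynomial_on UNIV P' \<and> (\<forall>y\<in>Y. P' y = P y) \<and>
           two_polynomial_norm (max_norm \<Pi>1 \<Pi>2) UNIV P' =
           two_polynomial_norm (max_norm \<Pi>1 \<Pi>2) Y P"
proof -
  let ?N = "max_norm \<Pi>1 \<Pi>2"
  obtain b where b: "bilinear_on Y b" and P: "\<And>y. y \<in> Y \<Longrightarrow> P y = b y y"
    using assms(4) unfolding two_polynomial_on_def by blast
  have increase: "two_polynomial_norm ?N Y P \<le> two_polynomial_norm ?N UNIV P'"
    if "\<And>y. y \<in> Y \<Longrightarrow> P' y = P y" for P'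
    unfolding two_polynomial_norm_def using that by (intro SUP_mono) auto
  show ?thesis
  proof (cases "two_polynomial_norm ?N Y P" rule: ennreal_cases)
    case (real c)
    have "\<bar>b y y\<bar> \<le> c * max (\<Pi>1 y y) (\<Pi>2 y y)" if "y \<in> Y" for y
      using two_polynomial_norm_bound[OF assms(1-3) b P real(1) _ that] real(2) by simp
    then obtain b' where b': "bilinear_on UNIV b'" "\<And>y. y \<in> Y \<Longrightarrow> b' y y = b y y"
        and bound: "\<And>x. \<bar>b' x x\<bar> \<le> c * max (\<Pi>1 x x) (\<Pi>2 x x)"
      using extend_bounded_by_max[OF assms(1,2) real(1) assms(3) b] by blast
    have "\<bar>b' x x\<bar> \<le> c" if "?N x = 1" for x
      using bound[of x] that unfolding max_norm_square[OF assms(1,2), symmetric] by simp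
    then have "two_polynomial_norm ?N UNIV (\<lambda>x. b' x x) \<le> two_polynomial_norm ?N Y P"
      unfolding real(2) unfolding two_polynomial_norm_def
      by (intro SUP_least) (simp add: ennreal_leI)
    moreover have "two_polynomial_on UNIV (\<lambda>x. b' x x)"
      unfolding two_polynomial_on_def using b'(1) by blast
    ultimately show ?thesis
      using b'(2) P increase[of "\<lambda>x. b' x x"]
      by (intro exI[of _ "\<lambda>x. b' x x"]) (auto intro: antisym)
  next
    \<comment> \<open>The value \<open>\<infinity>\<close> can only persist under extension, so any extension will do.\<close>
    case top
    obtain p where p: "linear p" "\<And>x. p x \<in> Y" and id: "\<And>y. y \<in> Y \<Longrightarrow> p y = y"
      using orthogonal_projection_exists[OF assms(1,3)] by metis
    have "two_polynomial_on UNIV (\<lambda>x. b (p x) (p x))"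
      unfolding two_polynomial_on_def using bilinear_on_comp_linear[OF b p] by blast
    then show ?thesis
      using id P increase[of "\<lambda>x. b (p x) (p x)"] top
      by (intro exI[of _ "\<lambda>x. b (p x) (p x)"]) (auto simp: top_unique)
  qed
qed

end
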